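(* Let $\mathcal B$ be a Banach algebra with unit $e$, $A\subseteq\mathcal B$ a subalgebra with $e\in A$, $\mathcal J\subseteq\mathcal B$ a proper closed two-sided ideal of $\mathcal B$, and $I\subseteq A$ a two-sided ideal of $A$ with $I\subseteq\mathcal J$. Let $\varphi:A/I\to\mathcal B/\mathcal J$, $a+I\mapsto a+\mathcal J$, be the induced homomorphism of unital algebras. Let $(P_A)$ be taken with respect to the inclusion $A\to\mathcal B$, $(P_I)$ with respect to the inclusion $I\to\mathbb C e\oplus\mathcal J$, $(P_{A/I})$ with respect to $\varphi$, and let $(\widetilde P)$ be the property $\varphi^{-1}\big((\mathcal B/\mathcal J)^{-1}\big)=(A/I)^{-1}$. Then: (a) If $I$ is dense in $\mathcal J$, then $(P_I)$ together with $(\widetilde P)$ imply $(P_A)$. (b) If $I$ is dense in $\mathcal J$, then $(P_A)$ implies $(P_{A/I})$. (c) If $I$ is dense in $\mathcal J$ and $A$ is dense in $\mathcal B$, then $(P_A)$ implies $(\widetilde P)$. (d) $(P_A)$ implies $(P_I)$. (e) $(\widetilde P)$ implies $(P_{A/I})$; moreover, if $\varphi$ is one-to-one and $\varphi(A/I)$ is dense in $\mathcal B/\mathcal J$, then $(P_{A/I})$ holds if and only if $(\widetilde P)$ holds.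
   Context: For a unital algebra $R$, $R^{-1}$ denotes its group of invertible elements. Let $\mathcal C$ be a Banach algebra with unit $e$ and $\psi:R\to\mathcal C$ a morphism of algebras (unit preserving if $R$ has a unit). One says that $R$ has property $(P_R)$ in $\mathcal C$ (with respect to $\psi$), or is locally spectral invariant, if there exists $\varepsilon>0$ such that for all $x\in R$ with $\|\psi(x)\|_{\mathcal C}<\varepsilon$ the element $e+\psi(x)$ is invertible in $\mathcal C$ and $(e+\psi(x))^{-1}\in\mathbb C e+\psi(R)$. A Banach algebra quotient carries the quotient norm. *)

theory Defs
  imports "HOL-Analysis.Abstract_Metric_Spaces" "HOL-Algebra.QuotRing" "HOL-Algebra.Module"
    "HOL-Algebra.Subrings"
begin

definition complex_field :: "complex ring"
  where "complex_field = \<lparr>carrier = UNIV, mult = (*), one = 1, zero = 0, add = (+)\<rparr>"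

record 'a normed_algebra = "(complex, 'a) module" +
  nrm :: "'a \<Rightarrow> real"

text \<open>The locale \<^locale>\<open>Metric_space\<close> wants a distance that is nonnegative and symmetric on the whole
  type; hence the value 0 off the carrier, which plays no role in the topology on the carrier.\<close>

definition ndist :: "'a normed_algebra \<Rightarrow> 'a \<Rightarrow> 'a \<Rightarrow> real"
  where "ndist C x y =
    (if x \<in> carrier C \<and> y \<in> carrier C then nrm C (x \<ominus>\<^bsub>C\<^esub> y) else 0)"

definition ntopology :: "'a normed_algebra \<Rightarrow> 'a topology"
  where "ntopology C = Metric_space.mtopology (carrier C) (ndist C)"

definition dense_in :: "'a normed_algebra \<Rightarrow> 'a set \<Rightarrow> 'a set \<Rightarrow> bool"
  where "dense_in C S T \<longleftrightarrow> S \<subseteq> T \<and> T \<subseteq> ntopology C closure_of S"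

text \<open>The norm of the unit is not required to be 1.\<close>

locale unital_banach_algebra = ring B + scalars: module complex_field B
  for B :: "'a normed_algebra" (structure) +
  assumes smult_mult_left: "x \<in> carrier B \<Longrightarrow> y \<in> carrier B \<Longrightarrow> (c \<odot> x) \<otimes> y = c \<odot> (x \<otimes> y)"
    and smult_mult_right: "x \<in> carrier B \<Longrightarrow> y \<in> carrier B \<Longrightarrow> x \<otimes> (c \<odot> y) = c \<odot> (x \<otimes> y)"
    and nrm_nonneg: "x \<in> carrier B \<Longrightarrow> 0 \<le> nrm B x"
    and nrm_eq_0_iff: "x \<in> carrier B \<Longrightarrow> nrm B x = 0 \<longleftrightarrow> x = \<zero>"
    and nrm_triangle: "x \<in> carrier B \<Longrightarrow> y \<in> carrier B \<Longrightarrow> nrm B (x \<oplus> y) \<le> nrm B x + nrm B y"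
    and nrm_smult: "x \<in> carrier B \<Longrightarrow> nrm B (c \<odot> x) = cmod c * nrm B x"
    and nrm_mult: "x \<in> carrier B \<Longrightarrow> y \<in> carrier B \<Longrightarrow> nrm B (x \<otimes> y) \<le> nrm B x * nrm B y"
    and complete: "Metric_space.mcomplete (carrier B) (ndist B)"

text \<open>Ideals are taken to be ring ideals (\<^locale>\<open>ideal\<close>); in a unital algebra these are
  automatically closed under scalars, since \<open>c \<odot> x = (c \<odot> \<one>) \<otimes> x\<close>.\<close>

definition unital_subalgebra :: "'a set \<Rightarrow> 'a normed_algebra \<Rightarrow> bool"
  where "unital_subalgebra A B \<longleftrightarrow>
    subring A B \<and> (\<forall>c. \<forall>x\<in>A. c \<odot>\<^bsub>B\<^esub> x \<in> A)"

definition restrict_alg :: "'a normed_algebra \<Rightarrow> 'a set \<Rightarrow> 'a normed_algebra"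
  where "restrict_alg B A = B\<lparr>carrier := A\<rparr>"

text \<open>\<open>\<complex>e + S\<close>, with \<open>e\<close> the unit of \<open>B\<close>.\<close>

definition unitization :: "'a normed_algebra \<Rightarrow> 'a set \<Rightarrow> 'a set"
  where "unitization B S = {c \<odot>\<^bsub>B\<^esub> \<one>\<^bsub>B\<^esub> \<oplus>\<^bsub>B\<^esub> s | c s. s \<in> S}"

definition quot_smult :: "'a normed_algebra \<Rightarrow> 'a set \<Rightarrow> complex \<Rightarrow> 'a set \<Rightarrow> 'a set"
  where "quot_smult B J c X = (\<Union>x\<in>X. J +>\<^bsub>B\<^esub> (c \<odot>\<^bsub>B\<^esub> x))"

definition quot_nrm :: "'a normed_algebra \<Rightarrow> 'a set \<Rightarrow> real"
  where "quot_nrm B X = (INF x\<in>X. nrm B x)"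

definition quotient_algebra :: "'a normed_algebra \<Rightarrow> 'a set \<Rightarrow> 'a set normed_algebra"
  where "quotient_algebra B J =
    \<lparr>carrier = carrier (B Quot J), mult = mult (B Quot J), one = one (B Quot J),
      zero = zero (B Quot J), add = add (B Quot J), smult = quot_smult B J, nrm = quot_nrm B\<rparr>"

text \<open>The map \<open>a + I \<mapsto> a + J\<close>; the union is over one and the same coset when \<open>I \<subseteq> J\<close>,
  see \<open>induced_map_coset\<close> below.\<close>

definition induced_map :: "'a normed_algebra \<Rightarrow> 'a set \<Rightarrow> 'a set \<Rightarrow> 'a set"
  where "induced_map B J X = (\<Union>x\<in>X. J +>\<^bsub>B\<^esub> x)"

text \<open>Local spectral invariance of an algebra with underlying set \<open>R\<close>, with respect to
  the morphism \<open>\<psi>\<close> from \<open>R\<close> to the Banach algebra \<open>C\<close>.\<close>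

definition locally_spectral_invariant ::
    "'r set \<Rightarrow> 'c normed_algebra \<Rightarrow> ('r \<Rightarrow> 'c) \<Rightarrow> bool"
  where "locally_spectral_invariant R C \<psi> \<longleftrightarrow>
    (\<exists>\<epsilon>>0. \<forall>x\<in>R. nrm C (\<psi> x) < \<epsilon> \<longrightarrow>
      \<one>\<^bsub>C\<^esub> \<oplus>\<^bsub>C\<^esub> \<psi> x \<in> Units C \<and>
      inv\<^bsub>C\<^esub> (\<one>\<^bsub>C\<^esub> \<oplus>\<^bsub>C\<^esub> \<psi> x) \<in> unitization C (\<psi> ` R))"

definition spectral_invariant :: "'r ring \<Rightarrow> 'c normed_algebra \<Rightarrow> ('r \<Rightarrow> 'c) \<Rightarrow> bool"
  where "spectral_invariant R C \<psi> \<longleftrightarrow> {x \<in> carrier R. \<psi> x \<in> Units C} = Units R"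

lemma quotient_algebra_simps [simp]:
  "carrier (quotient_algebra B J) = a_rcosets\<^bsub>B\<^esub> J"
  "mult (quotient_algebra B J) = rcoset_mult B J"
  "one (quotient_algebra B J) = J +>\<^bsub>B\<^esub> \<one>\<^bsub>B\<^esub>"
  "zero (quotient_algebra B J) = J"
  "add (quotient_algebra B J) = set_add B"
  "smult (quotient_algebra B J) = quot_smult B J"
  "nrm (quotient_algebra B J) = quot_nrm B"
  by (simp_all add: quotient_algebra_def FactRing_def)

lemma (in unital_banach_algebra) Metric_space_ndist: "Metric_space (carrier B) (ndist B)"
proof
  have neg: "nrm B (\<ominus> x) = nrm B x" if "x \<in> carrier B" for x
  proof -
    have "(0::complex) \<odot> x = \<zero>"
    proof -
      have "nrm B (0 \<odot> x) = 0" using nrm_smult[OF that, of 0] by simp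
      then show ?thesis
        using nrm_eq_0_iff[of "0 \<odot> x"] scalars.smult_closed[of 0 x] that
        by (simp add: complex_field_def)
    qed
    moreover have "((1::complex) + (-1)) \<odot> x = 1 \<odot> x \<oplus> (-1) \<odot> x"
      using scalars.smult_l_distr[of 1 "-1" x] that by (simp add: complex_field_def)
    moreover have "(1::complex) \<odot> x = x"
      using scalars.smult_one[OF that] by (simp add: complex_field_def)
    moreover have "(-1) \<odot> x \<in> carrier B"
      using scalars.smult_closed[of "-1" x] that by (simp add: complex_field_def)
    ultimately have "(-1) \<odot> x = \<ominus> x"
      using that minus_equality[of "(-1) \<odot> x" x] a_comm[of x "(-1) \<odot> x"] by simp
    then show ?thesis using nrm_smult[OF that, of "-1"] by simp
  qed
  fix x y
  show "0 \<le> ndist B x y" by (simp add: ndist_def nrm_nonneg)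
  show "ndist B x y = ndist B y x"
  proof (cases "x \<in> carrier B \<and> y \<in> carrier B")
    case True
    then have "\<ominus> (x \<ominus> y) = y \<ominus> x"
      by (simp add: a_minus_def minus_add a_comm)
    then show ?thesis using True neg[of "x \<ominus> y"] by (simp add: ndist_def)
  qed (auto simp: ndist_def)
  show "ndist B x y = 0 \<longleftrightarrow> x = y" if "x \<in> carrier B" "y \<in> carrier B"
    using that by (simp add: ndist_def nrm_eq_0_iff)
  show "ndist B x z \<le> ndist B x y + ndist B y z"
    if "x \<in> carrier B" "y \<in> carrier B" "z \<in> carrier B" for z
  proof -
    have "x \<ominus> z = (x \<ominus> y) \<oplus> (y \<ominus> z)"
      using that by (simp add: a_minus_def a_assoc r_neg1)
    then show ?thesis
      using that nrm_triangle[of "x \<ominus> y" "y \<ominus> z"] by (simp add: ndist_def)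
  qed
qed

lemma (in unital_banach_algebra) induced_map_coset:
  assumes "ideal J B" "I \<subseteq> J" "\<zero> \<in> I" "a \<in> carrier B"
  shows "induced_map B J (I +> a) = J +> a"
proof -
  interpret J: ideal J B by fact
  have "J +> (i \<oplus> a) = J +> a" if "i \<in> I" for i
  proof -
    have "i \<in> J" "i \<in> carrier B" using that assms(2) J.a_subset by auto
    then show ?thesis
      using J.a_rcos_const a_coset_add_assoc[OF J.a_subset] assms(4) by metis
  qed
  then show ?thesis
    using assms(3) by (auto simp: induced_map_def a_r_coset_def')
qed

lemma (in unital_banach_algebra) quot_smult_coset:
  assumes "ideal J B" "a \<in> carrier B"
  shows "quot_smult B J c (J +> a) = J +> (c \<odot> a)"
proof -
  interpret J: ideal J B by fact
  have cc: "c \<odot> x \<in> carrier B" if "x \<in> carrier B" for x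
    using scalars.smult_closed[of c x] that by (simp add: complex_field_def)
  have "J +> (c \<odot> (j \<oplus> a)) = J +> (c \<odot> a)" if j: "j \<in> J" for j
  proof -
    have jB: "j \<in> carrier B" using j J.a_subset by auto
    have "c \<odot> (j \<oplus> a) = c \<odot> j \<oplus> c \<odot> a"
      using scalars.smult_r_distr[of c j a] jB assms(2) by (simp add: complex_field_def)
    moreover have "c \<odot> j = (c \<odot> \<one>) \<otimes> j"
      using smult_mult_left[of \<one> j c] jB by simp
    then have "c \<odot> j \<in> J" using J.I_l_closed[OF j cc[of \<one>]] by simp
    ultimately show ?thesis
      using J.a_rcos_const cc[OF assms(2)] cc[OF jB] a_coset_add_assoc[OF J.a_subset]
      by metis
  qed
  moreover have "\<zero> \<in> J" by simp
  ultimately show ?thesis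
    by (auto simp: quot_smult_def a_r_coset_def')
qed

end

theory Submission
  imports Defs
begin

text \<open>
  Everything is a perturbation argument around the unit. An inverse modulo the large ideal \<open>J\<close> is an
  identity \<open>a \<otimes> b = k \<oplus> \<one>\<close> with \<open>k \<in> J\<close>. By density, \<open>b\<close> can be replaced by an element of \<open>A\<close> and
  \<open>k\<close> by an element of \<open>I\<close> at the cost of a small error, which is absorbed by local spectral
  invariance; the corrected inverse lies in \<open>A\<close>. In the same way, for (a), an inverse of \<open>\<one> \<oplus> a\<close> modulo
  \<open>I\<close> is corrected first by an element of \<open>I\<close> and then by a factor in \<open>\<complex>e + I\<close>. If no density of \<open>I\<close> in
  \<open>J\<close> is available, injectivity of the induced map turns congruences modulo \<open>J\<close> into congruences
  modulo \<open>I\<close>.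
\<close>

section \<open>Contractions, inverses modulo an ideal, and approximation\<close>

text \<open>Picard iteration from \<open>a\<close>: all iterates stay within a fixed distance
  \<open>K\<close> of \<open>a\<close>, and applying \<open>f\<close> a further \<open>n\<close>
  times shrinks this to \<open>c ^ n * K\<close>, so the iterates are Cauchy. It takes the place of
  the Neumann series when inverting elements near the unit.\<close>

lemma (in Metric_space) contraction_fixpoint:
  assumes complete: "mcomplete" and "a \<in> M" and f: "f \<in> M \<rightarrow> M" and c: "0 \<le> c" "c < 1"
    and contr: "\<And>x y. x \<in> M \<Longrightarrow> y \<in> M \<Longrightarrow> d (f x) (f y) \<le> c * d x y"
  shows "\<exists>x\<in>M. f x = x"
proof -
  define \<sigma> where "\<sigma> n = (f ^^ n) a" for n
  have \<sigma>M: "\<sigma> n \<in> M" for n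
    by (induction n) (use \<open>a \<in> M\<close> f in \<open>auto simp: \<sigma>_def\<close>)
  have \<sigma>_Suc: "\<sigma> (Suc n) = f (\<sigma> n)" for n by (simp add: \<sigma>_def)
  \<comment> \<open>\<open>K\<close> is the solution of \<open>K = d a (f a) + c * K\<close>, so the
    bound below reproduces itself in the induction.\<close>
  define K where "K = d a (f a) / (1 - c)"
  have "K \<ge> 0" using c by (simp add: K_def)
  have K: "d a (\<sigma> k) \<le> K" for k
  proof (induction k)
    case 0
    then show ?case using \<open>a \<in> M\<close> \<open>K \<ge> 0\<close> by (simp add: \<sigma>_def)
  next
    case (Suc k)
    have "d a (\<sigma> (Suc k)) \<le> d a (f a) + d (f a) (f (\<sigma> k))"
      using triangle[of a "f a" "f (\<sigma> k)"] \<open>a \<in> M\<close> f \<sigma>M by (auto simp: \<sigma>_Suc)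
    also have "\<dots> \<le> d a (f a) + c * K"
      using contr[OF \<open>a \<in> M\<close> \<sigma>M] mult_left_mono[OF Suc c(1)] by (smt (verit))
    also have "\<dots> = K" using c by (simp add: K_def field_simps)
    finally show ?case .
  qed
  have tail: "d (\<sigma> n) (\<sigma> (n + k)) \<le> c ^ n * K" for n k
  proof (induction n)
    case 0
    then show ?case using K by (simp add: \<sigma>_def)
  next
    case (Suc n)
    have "d (\<sigma> (Suc n)) (\<sigma> (Suc n + k)) \<le> c * d (\<sigma> n) (\<sigma> (n + k))"
      using contr \<sigma>M by (simp add: \<sigma>_Suc)
    also have "\<dots> \<le> c ^ Suc n * K" using mult_left_mono[OF Suc c(1)] by (simp add: mult.assoc)
    finally show ?case .
  qed
  have lim: "(\<lambda>n. c ^ n * K) \<longlonglongrightarrow> 0"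
    using tendsto_mult_left_zero[OF LIMSEQ_power_zero[of c], of K] c by simp
  have "MCauchy \<sigma>"
    unfolding MCauchy_def
  proof (intro conjI allI impI)
    show "range \<sigma> \<subseteq> M" using \<sigma>M by auto
    fix \<epsilon> :: real assume "\<epsilon> > 0"
    then obtain N where N: "c ^ n * K < \<epsilon>" if "n \<ge> N" for n
      using order_tendstoD(2)[OF lim] by (auto simp: eventually_sequentially)
    have less: "d (\<sigma> m) (\<sigma> n) < \<epsilon>" if "N \<le> m" "m \<le> n" for m n
      using tail[of m "n - m"] N[of m] that by auto
    have "d (\<sigma> m) (\<sigma> n) < \<epsilon>" if "N \<le> m" "N \<le> n" for m n
      using less[of m n] less[of n m] that commute[of "\<sigma> m" "\<sigma> n"] by (cases "m \<le> n") auto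
    then show "\<exists>N. \<forall>n n'. N \<le> n \<longrightarrow> N \<le> n' \<longrightarrow> d (\<sigma> n) (\<sigma> n') < \<epsilon>"
      by blast
  qed
  then obtain x where x: "limitin mtopology \<sigma> x sequentially"
    using complete by (auto simp: mcomplete_def)
  then have "x \<in> M" by (simp add: limitin_metric)
  have dx: "(\<lambda>n. d (\<sigma> n) x) \<longlonglongrightarrow> 0"
    using x by (simp add: limitin_metric_dist_null)
  \<comment> \<open>The detour through \<open>\<sigma> (Suc n) = f (\<sigma> n)\<close> bounds the
    distance by two quantities that vanish as \<open>n\<close> grows.\<close>
  have "d (f x) x \<le> c * d (\<sigma> n) x + d (\<sigma> (Suc n)) x" for n
    using triangle[of "f x" "\<sigma> (Suc n)" x] contr[OF \<open>x \<in> M\<close> \<sigma>M[of n]] \<open>x \<in> M\<close> f \<sigma>M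
      commute[of x "\<sigma> n"] \<sigma>_Suc[of n] by fastforce
  moreover have "(\<lambda>n. c * d (\<sigma> n) x + d (\<sigma> (Suc n)) x) \<longlonglongrightarrow> 0"
    using tendsto_add[OF tendsto_mult_right_zero[OF dx, of c] LIMSEQ_Suc[OF dx]] by simp
  ultimately have "d (f x) x \<le> 0"
    by (meson LIMSEQ_le_const)
  then have "f x = x"
    using f \<open>x \<in> M\<close> nonneg[of "f x" x] by (metis Pi_mem antisym zero)
  then show ?thesis using \<open>x \<in> M\<close> by auto
qed

text \<open>A left and a right inverse in the quotient ring automatically agree, so two unrelated
  representatives \<open>c\<close> and \<open>d\<close> may be allowed. Later arguments can
  therefore repair the two sides independently.\<close>

lemma (in ideal) FactRing_Units_iff:
  assumes a: "a \<in> carrier R"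
  shows "I +> a \<in> Units (R Quot I) \<longleftrightarrow>
    (\<exists>c\<in>carrier R. \<exists>d\<in>carrier R. a \<otimes> c \<in> I +> \<one> \<and> d \<otimes> a \<in> I +> \<one>)"
    (is "_ \<longleftrightarrow> ?rhs")
proof -
  have eq: "(I +> x = I +> y) \<longleftrightarrow> x \<in> I +> y" if "x \<in> carrier R" "y \<in> carrier R" for x y
    using that a_repr_independence' a_repr_independenceD by metis
  have carr: "carrier (R Quot I) = (+>) I ` carrier R"
    by (auto simp: FactRing_simps)
  interpret Q: ring "R Quot I" by (rule quotient_is_ring)
  note simps = FactRing_def[of R I] rcoset_mult_add eq
  show ?thesis
  proof
    assume "I +> a \<in> Units (R Quot I)"
    then show ?rhs
      using a unfolding Units_def carr by (fastforce simp: simps)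
  next
    assume ?rhs
    then obtain c d where "c \<in> carrier R" "d \<in> carrier R" "a \<otimes> c \<in> I +> \<one>" "d \<otimes> a \<in> I +> \<one>"
      by auto
    then have "(I +> a) \<otimes>\<^bsub>R Quot I\<^esub> (I +> c) = \<one>\<^bsub>R Quot I\<^esub>"
      and "(I +> d) \<otimes>\<^bsub>R Quot I\<^esub> (I +> a) = \<one>\<^bsub>R Quot I\<^esub>"
      using a by (simp_all add: simps)
    moreover have "I +> x \<in> carrier (R Quot I)" if "x \<in> carrier R" for x
      using that carr by auto
    ultimately show "I +> a \<in> Units (R Quot I)"
      using a \<open>c \<in> carrier R\<close> \<open>d \<in> carrier R\<close> Q.inv_unique unfolding Units_def
      by (metis (mono_tags, lifting) mem_Collect_eq)
  qed
qed

text \<open>With \<open>k = a \<otimes> c \<ominus> \<one>\<close> and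
  \<open>l = d \<otimes> a \<ominus> \<one>\<close> in the ideal, expanding
  \<open>d \<otimes> a \<otimes> c \<otimes> a\<close> in two ways expresses
  \<open>c \<otimes> a \<ominus> \<one>\<close> through \<open>k\<close> and \<open>l\<close>. This
  merges two one-sided inverses into the single two-sided one that (P_{A/I}) asks for.\<close>

lemma (in ideal) right_inverse_mod_imp_left:
  assumes "a \<in> carrier R" "c \<in> carrier R" "d \<in> carrier R"
    and "a \<otimes> c \<in> I +> \<one>" "d \<otimes> a \<in> I +> \<one>"
  shows "c \<otimes> a \<in> I +> \<one>"
proof -
  define k l where "k = a \<otimes> c \<ominus> \<one>" and "l = d \<otimes> a \<ominus> \<one>"
  have "k \<in> I" "l \<in> I"
    using assms a_rcos_module_minus[OF ring_axioms] by (simp_all add: k_def l_def)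
  moreover have "c \<otimes> a \<ominus> \<one> = l \<oplus> d \<otimes> k \<otimes> a \<ominus> l \<otimes> (c \<otimes> a)"
    using assms(1-3) unfolding k_def l_def by algebra
  ultimately have "c \<otimes> a \<ominus> \<one> \<in> I"
    using assms(1-3) I_l_closed I_r_closed by (simp add: a_minus_def)
  then show ?thesis
    using assms(1-3) a_rcos_module_minus[OF ring_axioms] by simp
qed

text \<open>Uniqueness of inverses lets the chosen inverse be traded for an explicit two-sided one
  in the unitization. A monoid is enough structure, so the same statement covers \<open>B\<close>,
  the subalgebra \<complex>e + \<open>J\<close> and the quotient.\<close>

lemma locally_spectral_invariant_iff:
  assumes "monoid C" and "unitization C (\<psi> ` R) \<subseteq> carrier C"
    and "\<And>x. x \<in> R \<Longrightarrow> \<one>\<^bsub>C\<^esub> \<oplus>\<^bsub>C\<^esub> \<psi> x \<in> carrier C"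
  shows "locally_spectral_invariant R C \<psi> \<longleftrightarrow>
    (\<exists>\<epsilon>>0. \<forall>x\<in>R. nrm C (\<psi> x) < \<epsilon> \<longrightarrow>
      (\<exists>y\<in>unitization C (\<psi> ` R). (\<one>\<^bsub>C\<^esub> \<oplus>\<^bsub>C\<^esub> \<psi> x) \<otimes>\<^bsub>C\<^esub> y = \<one>\<^bsub>C\<^esub> \<and>
        y \<otimes>\<^bsub>C\<^esub> (\<one>\<^bsub>C\<^esub> \<oplus>\<^bsub>C\<^esub> \<psi> x) = \<one>\<^bsub>C\<^esub>))"
proof -
  interpret C: monoid C by fact
  have "(u \<in> Units C \<and> inv\<^bsub>C\<^esub> u \<in> U) \<longleftrightarrow>
      (\<exists>y\<in>U. u \<otimes>\<^bsub>C\<^esub> y = \<one>\<^bsub>C\<^esub> \<and> y \<otimes>\<^bsub>C\<^esub> u = \<one>\<^bsub>C\<^esub>)"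
    if "u \<in> carrier C" "U \<subseteq> carrier C" for u U
  proof
    assume "u \<in> Units C \<and> inv\<^bsub>C\<^esub> u \<in> U"
    then show "\<exists>y\<in>U. u \<otimes>\<^bsub>C\<^esub> y = \<one>\<^bsub>C\<^esub> \<and> y \<otimes>\<^bsub>C\<^esub> u = \<one>\<^bsub>C\<^esub>"
      using C.Units_l_inv C.Units_r_inv by blast
  next
    assume "\<exists>y\<in>U. u \<otimes>\<^bsub>C\<^esub> y = \<one>\<^bsub>C\<^esub> \<and> y \<otimes>\<^bsub>C\<^esub> u = \<one>\<^bsub>C\<^esub>"
    then obtain y where y: "y \<in> U" "u \<otimes>\<^bsub>C\<^esub> y = \<one>\<^bsub>C\<^esub>" "y \<otimes>\<^bsub>C\<^esub> u = \<one>\<^bsub>C\<^esub>" by auto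
    then have "y \<in> carrier C" using that by auto
    then show "u \<in> Units C \<and> inv\<^bsub>C\<^esub> u \<in> U"
      using y that C.inv_unique'[of u y] unfolding Units_def by auto
  qed
  then show ?thesis
    using assms(2,3) by (simp add: locally_spectral_invariant_def cong: ball_cong)
qed

lemma (in ring) a_minus_swap: "\<lbrakk>x \<in> carrier R; y \<in> carrier R\<rbrakk> \<Longrightarrow> \<ominus> (x \<ominus> y) = y \<ominus> x"
  by (simp add: a_minus_def minus_add a_comm)

lemma (in ring) a_minus_trans:
  "\<lbrakk>x \<in> carrier R; y \<in> carrier R; z \<in> carrier R\<rbrakk> \<Longrightarrow> (x \<ominus> y) \<oplus> (y \<ominus> z) = x \<ominus> z"
  by (simp add: a_minus_def a_assoc r_neg1)

lemma (in ring) mult_a_minus: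
  assumes "x \<in> carrier R" "y \<in> carrier R" "z \<in> carrier R"
  shows "x \<otimes> (y \<ominus> z) = x \<otimes> y \<ominus> x \<otimes> z" "(y \<ominus> z) \<otimes> x = y \<otimes> x \<ominus> z \<otimes> x"
  using assms by (simp_all add: a_minus_def r_distr l_distr r_minus l_minus)

text \<open>The assumption is only that the distance is a metric, so that the lemma applies to the
  quotient algebra as well as to \<open>B\<close>.\<close>

lemma dense_in_approx:
  assumes "Metric_space (carrier C) (ndist C)" "dense_in C S T" "t \<in> T" "0 < r"
  obtains s where "s \<in> S" "s \<in> carrier C" "t \<in> carrier C" "nrm C (t \<ominus>\<^bsub>C\<^esub> s) < r"
proof -
  interpret Metric_space "carrier C" "ndist C" by fact
  have "t \<in> Metric_space.mtopology (carrier C) (ndist C) closure_of S"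
    using assms by (auto simp: dense_in_def ntopology_def)
  then obtain s where "s \<in> S" "t \<in> carrier C" "s \<in> mball t r"
    using \<open>0 < r\<close> by (auto simp: metric_closure_of)
  then show thesis using that by (auto simp: ndist_def)
qed

section \<open>Scalars, norm and units near the identity\<close>

context unital_banach_algebra
begin

interpretation metric: Metric_space "carrier B" "ndist B"
  by (rule Metric_space_ndist)

lemma smult_carrier [simp, intro]: "x \<in> carrier B \<Longrightarrow> c \<odot> x \<in> carrier B"
  using scalars.smult_closed[of c x] by (simp add: complex_field_def)

lemma smult_one_mult: "x \<in> carrier B \<Longrightarrow> (c \<odot> \<one>) \<otimes> x = c \<odot> x"
  by (simp add: smult_mult_left)

lemma smult_add: "x \<in> carrier B \<Longrightarrow> (a + b) \<odot> x = a \<odot> x \<oplus> b \<odot> x"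
  using scalars.smult_l_distr[of a b x] by (simp add: complex_field_def)

lemma smult_1: "x \<in> carrier B \<Longrightarrow> 1 \<odot> x = x"
  using scalars.smult_one by (simp add: complex_field_def)

lemma smult_smult: "x \<in> carrier B \<Longrightarrow> (a * b) \<odot> x = a \<odot> (b \<odot> x)"
  using scalars.smult_assoc1[of a b x] by (simp add: complex_field_def)

lemma smult_0: "x \<in> carrier B \<Longrightarrow> 0 \<odot> x = \<zero>"
  using nrm_smult[of x 0] nrm_eq_0_iff[of "0 \<odot> x"] by simp

lemma smult_minus_one: "x \<in> carrier B \<Longrightarrow> (-1) \<odot> x = \<ominus> x"
  using smult_add[of x "-1" 1] minus_equality[of "(-1) \<odot> x" x] by (simp add: smult_0 smult_1)

lemma nrm_minus: "x \<in> carrier B \<Longrightarrow> nrm B (\<ominus> x) = nrm B x"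
  using nrm_smult[of x "-1"] by (simp add: smult_minus_one)

lemma nrm_diff: "x \<in> carrier B \<Longrightarrow> y \<in> carrier B \<Longrightarrow> nrm B (x \<ominus> y) \<le> nrm B x + nrm B y"
  using nrm_triangle[of x "\<ominus> y"] by (simp add: a_minus_def nrm_minus)

text \<open>A right inverse \<open>s\<close> of \<open>\<one> \<oplus> x\<close> is a fixed point of the contraction \<open>s \<mapsto> \<one> \<ominus> x \<otimes> s\<close>.\<close>

lemma one_plus_Units:
  assumes x: "x \<in> carrier B" and "nrm B x < 1"
  shows "\<one> \<oplus> x \<in> Units B"
proof -
  have diff: "(\<one> \<ominus> u) \<ominus> (\<one> \<ominus> v) = v \<ominus> u" if "u \<in> carrier B" "v \<in> carrier B" for u v
    using that by algebra
  have fix_add: "y \<oplus> z = \<one>" if "\<one> \<ominus> y = z" "y \<in> carrier B" for y z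
    using that(2) unfolding that(1)[symmetric] by algebra
  have "\<exists>s\<in>carrier B. \<one> \<ominus> x \<otimes> s = s"
  proof (rule metric.contraction_fixpoint[OF complete, where c = "nrm B x" and a = \<zero>])
    fix u v assume "u \<in> carrier B" "v \<in> carrier B"
    then have "ndist B (\<one> \<ominus> x \<otimes> u) (\<one> \<ominus> x \<otimes> v) = nrm B (x \<otimes> (v \<ominus> u))"
      using x by (simp add: ndist_def diff mult_a_minus)
    also have "\<dots> \<le> nrm B x * ndist B v u"
      using nrm_mult[of x "v \<ominus> u"] x \<open>u \<in> carrier B\<close> \<open>v \<in> carrier B\<close> by (simp add: ndist_def)
    finally show "ndist B (\<one> \<ominus> x \<otimes> u) (\<one> \<ominus> x \<otimes> v) \<le> nrm B x * ndist B u v"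
      using metric.commute[of u v] by simp
  qed (use x assms(2) nrm_nonneg in auto)
  then obtain s where s: "s \<in> carrier B" "\<one> \<ominus> x \<otimes> s = s" by auto
  \<comment> \<open>Multiplication need not commute, so the mirrored contraction supplies a left
    inverse; the two one-sided inverses then coincide.\<close>
  have "\<exists>t\<in>carrier B. \<one> \<ominus> t \<otimes> x = t"
  proof (rule metric.contraction_fixpoint[OF complete, where c = "nrm B x" and a = \<zero>])
    fix u v assume "u \<in> carrier B" "v \<in> carrier B"
    then have "ndist B (\<one> \<ominus> u \<otimes> x) (\<one> \<ominus> v \<otimes> x) = nrm B ((v \<ominus> u) \<otimes> x)"
      using x by (simp add: ndist_def diff mult_a_minus)
    also have "\<dots> \<le> nrm B x * ndist B v u"
      using nrm_mult[of "v \<ominus> u" x] x \<open>u \<in> carrier B\<close> \<open>v \<in> carrier B\<close>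
      by (simp add: ndist_def mult.commute)
    finally show "ndist B (\<one> \<ominus> u \<otimes> x) (\<one> \<ominus> v \<otimes> x) \<le> nrm B x * ndist B u v"
      using metric.commute[of u v] by simp
  qed (use x assms(2) nrm_nonneg in auto)
  then obtain t where t: "t \<in> carrier B" "\<one> \<ominus> t \<otimes> x = t" by auto
  have "(\<one> \<oplus> x) \<otimes> s = \<one>" "t \<otimes> (\<one> \<oplus> x) = \<one>"
    using fix_add[OF s(2)] fix_add[OF t(2)] x s(1) t(1) by (simp_all add: l_distr r_distr a_comm)
  moreover from this have "t = s"
    using inv_unique[of t "\<one> \<oplus> x" s] x s(1) t(1) by simp
  ultimately show ?thesis
    using x s(1) unfolding Units_def by auto
qed

end

text \<open>Subtraction sees only the additive part of the record, which both structures share. This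
  gives access to the ring homomorphism onto \<open>B Quot J\<close> when computing differences of
  cosets.\<close>

lemma a_minus_quotient_algebra: "X \<ominus>\<^bsub>quotient_algebra B J\<^esub> Y = X \<ominus>\<^bsub>B Quot J\<^esub> Y"
  unfolding a_minus_def a_inv_def m_inv_def quotient_algebra_def by simp

subsection \<open>The Banach algebra pair and its quotients\<close>

locale banach_ideal_pair = unital_banach_algebra B for B :: "'a normed_algebra" (structure) +
  fixes A J I :: "'a set"
  assumes subalgebra: "unital_subalgebra A B"
    and J_ideal: "ideal J B"
    and J_closed: "closedin (ntopology B) J"
    and I_ideal: "ideal I (restrict_alg B A)"
    and I_subset_J: "I \<subseteq> J"
begin

interpretation metric: Metric_space "carrier B" "ndist B"
  by (rule Metric_space_ndist)

sublocale J: ideal J B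
  by (rule J_ideal)

lemma A_carrier: "x \<in> A \<Longrightarrow> x \<in> carrier B"
  and A_one [simp]: "\<one> \<in> A"
  and A_add [simp]: "x \<in> A \<Longrightarrow> y \<in> A \<Longrightarrow> x \<oplus> y \<in> A"
  and A_mult [simp]: "x \<in> A \<Longrightarrow> y \<in> A \<Longrightarrow> x \<otimes> y \<in> A"
  and A_uminus [simp]: "x \<in> A \<Longrightarrow> \<ominus> x \<in> A"
  and A_smult [simp]: "x \<in> A \<Longrightarrow> c \<odot> x \<in> A"
  using subalgebra subringE[of A B] unfolding unital_subalgebra_def by auto

lemma A_diff [simp]: "x \<in> A \<Longrightarrow> y \<in> A \<Longrightarrow> x \<ominus> y \<in> A"
  by (simp add: a_minus_def)

lemma I_A: "i \<in> I \<Longrightarrow> i \<in> A"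
  using additive_subgroup.a_subset[OF ideal.axioms(1)[OF I_ideal]] by (auto simp: restrict_alg_def)

lemma I_zero: "\<zero> \<in> I"
  using additive_subgroup.zero_closed[OF ideal.axioms(1)[OF I_ideal]] by (simp add: restrict_alg_def)

lemma I_add: "i \<in> I \<Longrightarrow> k \<in> I \<Longrightarrow> i \<oplus> k \<in> I"
  using additive_subgroup.a_closed[OF ideal.axioms(1)[OF I_ideal]] by (simp add: restrict_alg_def)

lemma I_mult:
  assumes "i \<in> I" "x \<in> A"
  shows "x \<otimes> i \<in> I" "i \<otimes> x \<in> I"
  using assms ideal.I_l_closed[OF I_ideal] ideal.I_r_closed[OF I_ideal]
  by (simp_all add: restrict_alg_def)

lemma I_carrier: "i \<in> I \<Longrightarrow> i \<in> carrier B"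
  by (simp add: A_carrier I_A)

lemma I_uminus: "i \<in> I \<Longrightarrow> \<ominus> i \<in> I"
  using I_mult(1)[of i "\<ominus> \<one>"] by (simp add: I_carrier l_minus)

lemma I_diff: "i \<in> I \<Longrightarrow> k \<in> I \<Longrightarrow> i \<ominus> k \<in> I"
  by (simp add: a_minus_def I_add I_uminus)

lemma mem_coset: "x \<in> S +> y \<longleftrightarrow> (\<exists>s\<in>S. x = s \<oplus> y)"
  by (auto simp: a_r_coset_def')

lemma J_coset_eq_iff:
  "x \<in> carrier B \<Longrightarrow> y \<in> carrier B \<Longrightarrow> J +> x = J +> y \<longleftrightarrow> x \<in> J +> y"
  using J.a_repr_independence' J.a_repr_independenceD by metis

lemma restrict_alg_simps [simp]:
  "carrier (restrict_alg B S) = S" "mult (restrict_alg B S) = mult B"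
  "one (restrict_alg B S) = \<one>" "zero (restrict_alg B S) = \<zero>" "add (restrict_alg B S) = add B"
  "smult (restrict_alg B S) = smult B" "nrm (restrict_alg B S) = nrm B"
  by (simp_all add: restrict_alg_def)

lemma restrict_coset [simp]: "I +>\<^bsub>restrict_alg B A\<^esub> x = I +> x"
  by (simp add: a_r_coset_def')

lemma carrier_A_Quot_I: "carrier (restrict_alg B A Quot I) = (+>) I ` A"
  by (auto simp: FactRing_def A_RCOSETS_def' a_r_coset_def')

lemma carrier_quotient_algebra: "carrier (quotient_algebra B J) = (+>) J ` carrier B"
  by (auto simp: A_RCOSETS_def' a_r_coset_def')

lemma J_coset_carrier: "x \<in> carrier B \<Longrightarrow> J +> x \<in> carrier (quotient_algebra B J)"
  using carrier_quotient_algebra by blast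

lemma induced_coset: "x \<in> A \<Longrightarrow> induced_map B J (I +> x) = J +> x"
  by (intro induced_map_coset J_ideal I_subset_J I_zero A_carrier)

lemma induced_image: "induced_map B J ` carrier (restrict_alg B A Quot I) = (+>) J ` A"
  by (auto simp: carrier_A_Quot_I image_image induced_coset)

lemma Units_quotient_algebra: "Units (quotient_algebra B J) = Units (B Quot J)"
  by (simp add: Units_def FactRing_def)

lemma monoid_quotient_algebra: "monoid (quotient_algebra B J)"
proof -
  interpret Q: ring "B Quot J" by (rule J.quotient_is_ring)
  show ?thesis
    using Q.monoid_axioms by (simp add: Group.monoid_def FactRing_def)
qed

lemma quotient_minus:
  assumes "x \<in> carrier B" "y \<in> carrier B"
  shows "(J +> x) \<ominus>\<^bsub>quotient_algebra B J\<^esub> (J +> y) = J +> (x \<ominus> y)"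
proof -
  interpret h: ring_hom_ring B "B Quot J" "(+>) J" by (rule J.rcos_ring_hom_ring)
  have "(J +> x) \<ominus>\<^bsub>quotient_algebra B J\<^esub> (J +> y) = (J +> x) \<ominus>\<^bsub>B Quot J\<^esub> (J +> y)"
    by (rule a_minus_quotient_algebra)
  also have "\<dots> = J +> (x \<ominus> y)"
    using assms by (simp add: a_minus_def)
  finally show ?thesis .
qed

section \<open>The quotient norm and its metric\<close>

text \<open>An infimum of a nonempty set bounded below is less than \<open>r\<close> exactly when
  some member is. From here on a small quotient norm is handled through a small representative
  instead of the infimum.\<close>

lemma quot_nrm_less_iff:
  assumes "x \<in> carrier B"
  shows "quot_nrm B (J +> x) < r \<longleftrightarrow> (\<exists>j\<in>J. nrm B (j \<oplus> x) < r)"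
proof -
  have "J +> x = (\<lambda>j. j \<oplus> x) ` J"
    by (auto simp: a_r_coset_def')
  then have "quot_nrm B (J +> x) = (INF j\<in>J. nrm B (j \<oplus> x))"
    by (simp add: quot_nrm_def image_image)
  moreover have "bdd_below ((\<lambda>j. nrm B (j \<oplus> x)) ` J)"
    using nrm_nonneg J.a_Hcarr assms by (intro bdd_belowI[of _ 0]) auto
  moreover have "J \<noteq> {}"
    using J.zero_closed by blast
  ultimately show ?thesis
    by (simp add: cINF_less_iff)
qed

lemma quot_nrm_nonneg: "x \<in> carrier B \<Longrightarrow> 0 \<le> quot_nrm B (J +> x)"
  using quot_nrm_less_iff[of x 0] nrm_nonneg J.a_Hcarr by (meson a_closed not_le)

lemma quot_nrm_uminus:
  assumes x: "x \<in> carrier B"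
  shows "quot_nrm B (J +> \<ominus> x) = quot_nrm B (J +> x)"
proof -
  \<comment> \<open>Negation is an involution, so this inequality at \<open>x\<close> and at
    \<open>\<ominus> x\<close> gives equality.\<close>
  have le: "quot_nrm B (J +> \<ominus> y) \<le> quot_nrm B (J +> y)" if y: "y \<in> carrier B" for y
  proof (rule dense_ge)
    fix r assume "quot_nrm B (J +> y) < r"
    then obtain j where j: "j \<in> J" "nrm B (j \<oplus> y) < r"
      using y quot_nrm_less_iff by auto
    then have "nrm B (\<ominus> j \<oplus> \<ominus> y) < r"
      using nrm_minus[of "j \<oplus> y"] y J.a_Hcarr by (simp add: minus_add)
    then show "quot_nrm B (J +> \<ominus> y) \<le> r"
      using j(1) y quot_nrm_less_iff[of "\<ominus> y" r] by auto
  qed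
  show ?thesis using le[of x] le[of "\<ominus> x"] x by simp
qed

lemma quot_nrm_triangle:
  assumes "x \<in> carrier B" "y \<in> carrier B"
  shows "quot_nrm B (J +> (x \<oplus> y)) \<le> quot_nrm B (J +> x) + quot_nrm B (J +> y)"
proof (rule field_le_epsilon)
  fix e :: real assume "0 < e"
  then obtain j k where j: "j \<in> J" "nrm B (j \<oplus> x) < quot_nrm B (J +> x) + e / 2"
    and k: "k \<in> J" "nrm B (k \<oplus> y) < quot_nrm B (J +> y) + e / 2"
    using quot_nrm_less_iff assms by (metis half_gt_zero less_add_same_cancel1)
  have "(j \<oplus> k) \<oplus> (x \<oplus> y) = (j \<oplus> x) \<oplus> (k \<oplus> y)"
    using assms j k J.a_Hcarr by (simp add: a_ac)
  then have "nrm B ((j \<oplus> k) \<oplus> (x \<oplus> y)) < quot_nrm B (J +> x) + quot_nrm B (J +> y) + e"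
    using nrm_triangle[of "j \<oplus> x" "k \<oplus> y"] assms j k J.a_Hcarr by simp
  then show "quot_nrm B (J +> (x \<oplus> y)) \<le> quot_nrm B (J +> x) + quot_nrm B (J +> y) + e"
    using quot_nrm_less_iff[of "x \<oplus> y"] assms j(1) k(1) by (meson J.a_closed a_closed less_imp_le)
qed

text \<open>Closedness of \<open>J\<close> enters here: representatives \<open>j \<oplus> x\<close>
  of arbitrarily small norm exhibit elements \<open>\<ominus> j\<close> of \<open>J\<close>
  arbitrarily close to \<open>x\<close>.\<close>

lemma quot_nrm_eq_0_iff:
  assumes x: "x \<in> carrier B"
  shows "quot_nrm B (J +> x) = 0 \<longleftrightarrow> x \<in> J"
proof
  assume 0: "quot_nrm B (J +> x) = 0"
  have "\<exists>y\<in>J. y \<in> metric.mball x r" if "r > 0" for r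
  proof -
    obtain j where j: "j \<in> J" "nrm B (j \<oplus> x) < r"
      using 0 \<open>r > 0\<close> quot_nrm_less_iff[OF x, of r] by auto
    then have "\<ominus> j \<in> J" "nrm B (x \<ominus> \<ominus> j) < r"
      using x J.a_Hcarr by (simp_all add: a_minus_def a_comm)
    then show ?thesis
      using x J.a_Hcarr by (auto simp: ndist_def)
  qed
  then have "x \<in> metric.mtopology closure_of J"
    using x by (auto simp: metric.metric_closure_of)
  then show "x \<in> J"
    using J_closed by (simp add: ntopology_def closure_of_closedin)
next
  assume "x \<in> J"
  moreover from this have "nrm B (\<ominus> x \<oplus> x) = 0"
    using x nrm_eq_0_iff[of \<zero>] by (simp add: l_neg)
  ultimately have "quot_nrm B (J +> x) < r" if "r > 0" for r
    using quot_nrm_less_iff[OF x, of r] that by (metis J.a_inv_closed)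
  then show "quot_nrm B (J +> x) = 0"
    using quot_nrm_nonneg[OF x] by (metis less_irrefl order_less_le)
qed

text \<open>Density in the quotient is phrased through the topology of \<open>ndist\<close>; it
  yields approximations in norm once \<open>ndist\<close> is known to be a metric.\<close>

lemma Metric_space_quotient_algebra:
  "Metric_space (carrier (quotient_algebra B J)) (ndist (quotient_algebra B J))"
proof -
  let ?Q = "quotient_algebra B J"
  note carr = carrier_quotient_algebra
  have coset: "J +> x \<in> carrier ?Q" if "x \<in> carrier B" for x
    using that by (rule J_coset_carrier)
  have nd: "ndist ?Q (J +> x) (J +> y) = quot_nrm B (J +> (x \<ominus> y))"
    if "x \<in> carrier B" "y \<in> carrier B" for x y
    using that coset by (simp only: ndist_def quotient_minus quotient_algebra_simps(7)) simp
  show ?thesis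
  proof
    fix X Y
    show "0 \<le> ndist ?Q X Y"
    proof (cases "X \<in> carrier ?Q \<and> Y \<in> carrier ?Q")
      case True
      then obtain x y where "x \<in> carrier B" "y \<in> carrier B" "X = J +> x" "Y = J +> y"
        by (auto simp: carr simp del: quotient_algebra_simps(1))
      then show ?thesis by (simp add: nd quot_nrm_nonneg)
    qed (auto simp: ndist_def)
    show "ndist ?Q X Y = ndist ?Q Y X"
    proof (cases "X \<in> carrier ?Q \<and> Y \<in> carrier ?Q")
      case True
      then obtain x y where xy: "x \<in> carrier B" "y \<in> carrier B" "X = J +> x" "Y = J +> y"
        by (auto simp: carr simp del: quotient_algebra_simps(1))
      then show ?thesis
        using quot_nrm_uminus[of "x \<ominus> y"] by (simp add: nd a_minus_swap)
    qed (auto simp: ndist_def)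
    assume "X \<in> carrier ?Q" "Y \<in> carrier ?Q"
    then obtain x y where xy: "x \<in> carrier B" "y \<in> carrier B" "X = J +> x" "Y = J +> y"
      by (auto simp: carr simp del: quotient_algebra_simps(1))
    then show "ndist ?Q X Y = 0 \<longleftrightarrow> X = Y"
      by (simp add: nd quot_nrm_eq_0_iff J_coset_eq_iff J.a_rcos_module_minus[OF ring_axioms])
    fix Z assume "Z \<in> carrier ?Q"
    then obtain z where z: "z \<in> carrier B" "Z = J +> z"
      by (auto simp: carr simp del: quotient_algebra_simps(1))
    then show "ndist ?Q X Z \<le> ndist ?Q X Y + ndist ?Q Y Z"
      using xy quot_nrm_triangle[of "x \<ominus> y" "y \<ominus> z"] by (simp add: nd a_minus_trans)
  qed
qed

text \<open>Density in the quotient is pulled back to \<open>B\<close>: an element of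
  \<open>A\<close> approximates \<open>b\<close> in the quotient norm, and a representative of small
  norm accounts for the extra \<open>j\<close>.\<close>

lemma quotient_dense_approx:
  assumes dense: "dense_in (quotient_algebra B J)
      (induced_map B J ` carrier (restrict_alg B A Quot I)) (carrier (quotient_algebra B J))"
    and "b \<in> carrier B" "0 < r"
  obtains c j where "c \<in> A" "j \<in> J" "nrm B (j \<oplus> (b \<ominus> c)) < r"
proof -
  have "J +> b \<in> carrier (quotient_algebra B J)"
    using assms(2) by (rule J_coset_carrier)
  from dense_in_approx[OF Metric_space_quotient_algebra dense this \<open>0 < r\<close>]
  obtain c where c: "c \<in> A"
    "nrm (quotient_algebra B J) ((J +> b) \<ominus>\<^bsub>quotient_algebra B J\<^esub> (J +> c)) < r"
    by (auto simp: induced_image)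
  then have "quot_nrm B (J +> (b \<ominus> c)) < r"
    using assms(2) A_carrier by (simp add: quotient_minus)
  then show thesis
    using that c(1) quot_nrm_less_iff assms(2) A_carrier by auto
qed

section \<open>The unitizations of \<open>A\<close>, \<open>I\<close> and \<open>J\<close>\<close>

lemma mem_unitizationE:
  assumes "x \<in> unitization B S" "S \<subseteq> carrier B"
  obtains c s where "s \<in> S" "s \<in> carrier B" "x = c \<odot> \<one> \<oplus> s"
  using assms by (auto simp: unitization_def)

lemma unitization_mono: "S \<subseteq> T \<Longrightarrow> unitization B S \<subseteq> unitization B T"
  by (auto simp: unitization_def)

lemma one_plus_mem_unitization: "s \<in> S \<Longrightarrow> \<one> \<oplus> s \<in> unitization B S"
  unfolding unitization_def using smult_1[OF one_closed] by (intro CollectI exI[of _ 1] exI[of _ s]) simp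

lemma unitization_A: "unitization B A = A"
proof
  show "unitization B A \<subseteq> A" by (auto simp: unitization_def)
  show "A \<subseteq> unitization B A"
  proof
    fix a assume "a \<in> A"
    then have "a = 0 \<odot> \<one> \<oplus> a" by (simp add: smult_0 A_carrier)
    then show "a \<in> unitization B A" using \<open>a \<in> A\<close> by (auto simp: unitization_def)
  qed
qed

lemma unitization_I_subset_A: "unitization B I \<subseteq> A"
  using unitization_mono[of I A] unitization_A I_A by auto

lemma unitization_J_carrier: "unitization B J \<subseteq> carrier B"
  using J.a_subset by (auto simp: unitization_def)

lemma unitization_J_mult:
  assumes "x \<in> unitization B J" "y \<in> unitization B J"
  shows "x \<otimes> y \<in> unitization B J"
proof -
  obtain c j where x: "j \<in> J" "j \<in> carrier B" "x = c \<odot> \<one> \<oplus> j"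
    using mem_unitizationE[OF assms(1) J.a_subset] .
  obtain d k where y: "k \<in> J" "k \<in> carrier B" "y = d \<odot> \<one> \<oplus> k"
    using mem_unitizationE[OF assms(2) J.a_subset] .
  have "x \<otimes> y = (c * d) \<odot> \<one> \<oplus> (c \<odot> \<one> \<otimes> k \<oplus> (j \<otimes> (d \<odot> \<one>) \<oplus> j \<otimes> k))"
    using x y by (simp add: l_distr r_distr smult_smult smult_one_mult a_ac)
  moreover have "c \<odot> \<one> \<otimes> k \<oplus> (j \<otimes> (d \<odot> \<one>) \<oplus> j \<otimes> k) \<in> J"
    using x y by (simp add: J.I_l_closed J.I_r_closed)
  ultimately show ?thesis by (auto simp: unitization_def)
qed

text \<open>Inverses in (P_I) are taken inside \<complex>e + \<open>J\<close>, not in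
  \<open>B\<close>; this is the structure required to unfold that property.\<close>

lemma monoid_unitization_J: "monoid (restrict_alg B (unitization B J))"
proof -
  have "submonoid (unitization B J) B"
    using unitization_J_carrier unitization_J_mult one_plus_mem_unitization[of \<zero> J]
    by unfold_locales auto
  then show ?thesis
    using submonoid.submonoid_is_monoid[OF _ monoid_axioms] by (simp add: restrict_alg_def)
qed

section \<open>The four properties in terms of elements of \<open>B\<close>\<close>

lemma P_A_iff:
  "locally_spectral_invariant A B (\<lambda>a. a) \<longleftrightarrow>
    (\<exists>\<epsilon>>0. \<forall>x\<in>A. nrm B x < \<epsilon> \<longrightarrow> (\<exists>y\<in>A. (\<one> \<oplus> x) \<otimes> y = \<one> \<and> y \<otimes> (\<one> \<oplus> x) = \<one>))"
  using locally_spectral_invariant_iff[OF monoid_axioms, of "\<lambda>a. a" A] A_carrier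
  by (auto simp: unitization_A)

text \<open>An inverse lying in \<complex>e + \<open>I\<close> already lies in \<complex>e +
  \<open>J\<close>, and products there are those of \<open>B\<close>. So the ambient algebra drops
  out and the property becomes comparable with \<open>P_A_iff\<close>.\<close>

lemma P_I_iff:
  "locally_spectral_invariant I (restrict_alg B (unitization B J)) (\<lambda>i. i) \<longleftrightarrow>
    (\<exists>\<epsilon>>0. \<forall>x\<in>I. nrm B x < \<epsilon> \<longrightarrow>
      (\<exists>y\<in>unitization B I. (\<one> \<oplus> x) \<otimes> y = \<one> \<and> y \<otimes> (\<one> \<oplus> x) = \<one>))"
proof -
  have [simp]: "unitization (restrict_alg B T) S = unitization B S" for S T
    by (simp add: unitization_def)
  show ?thesis
    using locally_spectral_invariant_iff[OF monoid_unitization_J, of "\<lambda>i. i" I] I_subset_J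
      unitization_mono[OF I_subset_J] one_plus_mem_unitization[of _ J]
    by (simp add: subset_eq)
qed

text \<open>Small classes become small representatives, and an inverse in the image of
  \<open>A\<close> becomes a congruence modulo \<open>J\<close>.\<close>

lemma P_AI_iff:
  "locally_spectral_invariant (carrier (restrict_alg B A Quot I)) (quotient_algebra B J)
      (induced_map B J) \<longleftrightarrow>
    (\<exists>\<epsilon>>0. \<forall>x\<in>A. (\<exists>j\<in>J. nrm B (j \<oplus> x) < \<epsilon>) \<longrightarrow>
      (\<exists>y\<in>A. (\<one> \<oplus> x) \<otimes> y \<in> J +> \<one> \<and> y \<otimes> (\<one> \<oplus> x) \<in> J +> \<one>))"
proof -
  let ?Q = "quotient_algebra B J"
  have coset_add: "(J +> \<one>) \<oplus>\<^bsub>?Q\<^esub> (J +> x) = J +> (\<one> \<oplus> x)" if "x \<in> A" for x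
    using that by (simp add: J.a_rcos_sum A_carrier)
  \<comment> \<open>The image contains the class of the unit and is closed under scalars, so adding
    multiples of the unit changes nothing.\<close>
  have unit: "unitization ?Q ((+>) J ` A) = (+>) J ` A"
  proof
    show "unitization ?Q ((+>) J ` A) \<subseteq> (+>) J ` A"
      by (auto simp: unitization_def quot_smult_coset[OF J_ideal] J.a_rcos_sum A_carrier)
    show "(+>) J ` A \<subseteq> unitization ?Q ((+>) J ` A)"
    proof clarify
      fix a assume "a \<in> A"
      then have "J +> a = 0 \<odot>\<^bsub>?Q\<^esub> \<one>\<^bsub>?Q\<^esub> \<oplus>\<^bsub>?Q\<^esub> (J +> a)"
        by (simp add: quot_smult_coset[OF J_ideal] J.a_rcos_sum A_carrier smult_0)
      then show "J +> a \<in> unitization ?Q ((+>) J ` A)"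
        using \<open>a \<in> A\<close> unfolding unitization_def by blast
    qed
  qed
  have sub: "unitization ?Q (induced_map B J ` carrier (restrict_alg B A Quot I)) \<subseteq> carrier ?Q"
    unfolding induced_image unit carrier_quotient_algebra using A_carrier by auto
  have mem: "\<one>\<^bsub>?Q\<^esub> \<oplus>\<^bsub>?Q\<^esub> induced_map B J X \<in> carrier ?Q"
    if "X \<in> carrier (restrict_alg B A Quot I)" for X
    using that coset_add A_carrier
    unfolding carrier_A_Quot_I carrier_quotient_algebra by (auto simp: induced_coset)
  show ?thesis
    by (subst locally_spectral_invariant_iff[OF monoid_quotient_algebra sub], erule mem,
        unfold induced_image unit)
      (simp add: carrier_A_Quot_I induced_coset coset_add
        quot_nrm_less_iff A_carrier J.rcoset_mult_add J_coset_eq_iff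
        del: quotient_algebra_simps(5) cong: ball_cong conj_cong)
qed

text \<open>Units of the small quotient are mapped to units because \<open>I \<subseteq> J\<close>,
  so only the reverse implication carries content. Left and right inverses are kept apart in view of
  \<open>FactRing_Units_iff\<close>.\<close>

lemma P_tilde_iff:
  "spectral_invariant (restrict_alg B A Quot I) (quotient_algebra B J) (induced_map B J) \<longleftrightarrow>
    (\<forall>a\<in>A. (\<exists>c\<in>carrier B. \<exists>d\<in>carrier B. a \<otimes> c \<in> J +> \<one> \<and> d \<otimes> a \<in> J +> \<one>) \<longrightarrow>
      (\<exists>c\<in>A. \<exists>d\<in>A. a \<otimes> c \<in> I +> \<one> \<and> d \<otimes> a \<in> I +> \<one>))"
proof -
  let ?AI = "restrict_alg B A Quot I"
  interpret I: ideal I "restrict_alg B A" by (rule I_ideal)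
  have UI: "I +> a \<in> Units ?AI \<longleftrightarrow>
      (\<exists>c\<in>A. \<exists>d\<in>A. a \<otimes> c \<in> I +> \<one> \<and> d \<otimes> a \<in> I +> \<one>)" if "a \<in> A" for a
    using I.FactRing_Units_iff[of a] that by simp
  have UJ: "induced_map B J (I +> a) \<in> Units (quotient_algebra B J) \<longleftrightarrow>
      (\<exists>c\<in>carrier B. \<exists>d\<in>carrier B. a \<otimes> c \<in> J +> \<one> \<and> d \<otimes> a \<in> J +> \<one>)" if "a \<in> A" for a
    using J.FactRing_Units_iff[of a] that by (simp add: A_carrier induced_coset Units_quotient_algebra)
  have "I +> \<one> \<subseteq> J +> \<one>"
    using I_subset_J unfolding mem_coset subset_iff by blast
  then have rev: "induced_map B J (I +> a) \<in> Units (quotient_algebra B J)"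
    if "a \<in> A" "I +> a \<in> Units ?AI" for a
    using that UI UJ A_carrier by blast
  have "spectral_invariant ?AI (quotient_algebra B J) (induced_map B J) \<longleftrightarrow>
    (\<forall>a\<in>A. induced_map B J (I +> a) \<in> Units (quotient_algebra B J) \<longrightarrow> I +> a \<in> Units ?AI)"
  proof
    assume "spectral_invariant ?AI (quotient_algebra B J) (induced_map B J)"
    then show "\<forall>a\<in>A. induced_map B J (I +> a) \<in> Units (quotient_algebra B J) \<longrightarrow> I +> a \<in> Units ?AI"
      by (auto simp: spectral_invariant_def carrier_A_Quot_I)
  next
    assume "\<forall>a\<in>A. induced_map B J (I +> a) \<in> Units (quotient_algebra B J) \<longrightarrow> I +> a \<in> Units ?AI"
    moreover have "Units ?AI \<subseteq> (+>) I ` A"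
      using carrier_A_Quot_I by (auto simp: Units_def)
    ultimately show "spectral_invariant ?AI (quotient_algebra B J) (induced_map B J)"
      using rev by (auto simp: spectral_invariant_def carrier_A_Quot_I)
  qed
  then show ?thesis using UI UJ by simp
qed

text \<open>Both \<open>x\<close> and \<open>\<one>\<close> lie in \<open>A\<close>, so their
  classes modulo \<open>I\<close> belong to the domain of the injective map, where they have the
  same image.\<close>

lemma inj_coset:
  assumes "inj_on (induced_map B J) (carrier (restrict_alg B A Quot I))" "x \<in> A" "x \<in> J +> \<one>"
  shows "x \<in> I +> \<one>"
proof -
  have "J +> x = J +> \<one>" using assms A_carrier J_coset_eq_iff by auto
  then have "I +> x = I +> \<one>"
    using inj_onD[OF assms(1), of "I +> x" "I +> \<one>"] assms(2)
    by (auto simp: carrier_A_Quot_I induced_coset)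
  moreover have "x \<in> I +> x"
    using I_zero assms(2) A_carrier by (force simp: mem_coset)
  ultimately show ?thesis by simp
qed

subsection \<open>The implications\<close>

text \<open>The added 1 keeps the denominator positive even for \<open>a = \<zero>\<close>.\<close>

lemma nrm_mult_less:
  assumes "a \<in> carrier B" "x \<in> carrier B" "nrm B x < \<epsilon> / (nrm B a + 1)"
  shows "nrm B (a \<otimes> x) < \<epsilon>" "nrm B (x \<otimes> a) < \<epsilon>"
proof -
  have "nrm B a * nrm B x \<le> (nrm B a + 1) * nrm B x"
    using nrm_nonneg assms by (simp add: mult_right_mono)
  also have "\<dots> < \<epsilon>"
    using nrm_nonneg[OF assms(1)] assms(3) by (simp add: field_simps)
  finally show "nrm B (a \<otimes> x) < \<epsilon>" "nrm B (x \<otimes> a) < \<epsilon>"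
    using nrm_mult[of a x] nrm_mult[of x a] assms(1,2) by (auto simp: mult.commute)
qed

text \<open>Adding \<open>j\<close> does not change the class modulo \<open>J\<close>, so the
  inverse of \<open>u\<close> in \<open>B\<close> serves for \<open>j \<oplus> u\<close> as
  well.\<close>

lemma Units_imp_coset_inverses:
  assumes "u \<in> Units B" "j \<in> J"
  shows "\<exists>v\<in>carrier B. (j \<oplus> u) \<otimes> v \<in> J +> \<one> \<and> v \<otimes> (j \<oplus> u) \<in> J +> \<one>"
proof -
  obtain v where v: "v \<in> carrier B" "u \<otimes> v = \<one>" "v \<otimes> u = \<one>"
    using assms(1) by (auto simp: Units_def)
  have "(j \<oplus> u) \<otimes> v = j \<otimes> v \<oplus> \<one>" "v \<otimes> (j \<oplus> u) = v \<otimes> j \<oplus> \<one>"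
    using v assms J.a_Hcarr Units_closed by (simp_all add: l_distr r_distr)
  then show ?thesis
    using v(1) assms(2) J.I_l_closed J.I_r_closed unfolding mem_coset by blast
qed

text \<open>Let \<open>u = \<one> \<oplus> a\<close> have inverse \<open>b\<close> in
  \<open>B\<close>. The property of the quotients yields \<open>y\<close> in \<open>A\<close> with
  \<open>u \<otimes> y = i \<oplus> \<one>\<close>; for suitable \<open>k\<close> in
  \<open>I\<close> the product \<open>u \<otimes> (y \<ominus> k)\<close> is so close to
  \<open>\<one>\<close> that (P_I) inverts it by some \<open>z\<close> in \<open>A\<close>, and then
  \<open>b = (y \<ominus> k) \<otimes> z\<close>.\<close>

lemma P_I_and_P_tilde_imp_P_A:
  assumes dense: "dense_in B I J"
    and P_I: "locally_spectral_invariant I (restrict_alg B (unitization B J)) (\<lambda>i. i)"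
    and P_tilde: "spectral_invariant (restrict_alg B A Quot I) (quotient_algebra B J)
      (induced_map B J)"
  shows "locally_spectral_invariant A B (\<lambda>a. a)"
  unfolding P_A_iff
\<comment> \<open>Radius 1 ensures that \<open>\<one> \<oplus> a\<close> is invertible in
  \<open>B\<close>; the radius from (P_I) is met later by the choice of \<open>k\<close>.\<close>
proof (intro exI[of _ 1] conjI ballI impI)
  from P_I obtain \<epsilon> where "\<epsilon> > 0" and \<epsilon>: "\<And>x. x \<in> I \<Longrightarrow> nrm B x < \<epsilon> \<Longrightarrow>
      \<exists>y\<in>unitization B I. (\<one> \<oplus> x) \<otimes> y = \<one> \<and> y \<otimes> (\<one> \<oplus> x) = \<one>"
    unfolding P_I_iff by blast
  fix a assume a: "a \<in> A" "nrm B a < 1"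
  define u where "u = \<one> \<oplus> a"
  have u: "u \<in> A" "u \<in> carrier B" "u \<in> Units B"
    using a one_plus_Units by (simp_all add: u_def A_carrier)
  obtain b where b: "b \<in> carrier B" "u \<otimes> b = \<one>" "b \<otimes> u = \<one>"
    using u(3) by (auto simp: Units_def)
  have "\<exists>v\<in>carrier B. u \<otimes> v \<in> J +> \<one> \<and> v \<otimes> u \<in> J +> \<one>"
    using Units_imp_coset_inverses[OF u(3) J.zero_closed] u(2) by simp
  then obtain y i where y: "y \<in> A" and i: "i \<in> I" "u \<otimes> y = i \<oplus> \<one>"
    using P_tilde u(1) unfolding P_tilde_iff mem_coset by metis
  note carr = u(2) b(1) A_carrier[OF y] I_carrier[OF i(1)]
  \<comment> \<open>The exact correction of \<open>y\<close> is \<open>b \<otimes> i\<close>, since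
    \<open>y \<ominus> b \<otimes> i = b\<close>. It is only known to lie in \<open>J\<close>, so
    density replaces it by \<open>k\<close> in \<open>I\<close>, with a tolerance that survives
    multiplication by \<open>u\<close>.\<close>
  have "b \<otimes> i \<in> J" using b(1) i(1) I_subset_J J.I_l_closed by auto
  moreover have "\<epsilon> / (nrm B u + 1) > 0"
    using \<open>\<epsilon> > 0\<close> nrm_nonneg[OF u(2)] by (simp add: add_nonneg_pos)
  ultimately obtain k where k: "k \<in> I" "k \<in> carrier B"
      "nrm B (b \<otimes> i \<ominus> k) < \<epsilon> / (nrm B u + 1)"
    using dense_in_approx[OF Metric_space_ndist dense] by metis
  have "u \<otimes> (b \<otimes> i \<ominus> k) = i \<ominus> u \<otimes> k"
    using carr k(2) b(2) by (simp add: mult_a_minus m_assoc[symmetric])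
  then have "nrm B (i \<ominus> u \<otimes> k) < \<epsilon>"
    using nrm_mult_less(1)[OF _ _ k(3)] carr k(2) by simp
  moreover have "i \<ominus> u \<otimes> k \<in> I"
    using i(1) k(1) u(1) by (simp add: I_diff I_mult)
  ultimately obtain z where z: "z \<in> unitization B I" "(\<one> \<oplus> (i \<ominus> u \<otimes> k)) \<otimes> z = \<one>"
    using \<epsilon> by blast
  then have "z \<in> A" using unitization_I_subset_A by auto
  have "\<one> \<oplus> (i \<ominus> u \<otimes> k) = (i \<oplus> \<one>) \<ominus> u \<otimes> k"
    using carr k(2) by algebra
  then have "\<one> \<oplus> (i \<ominus> u \<otimes> k) = u \<otimes> (y \<ominus> k)"
    using carr k(2) i(2) by (simp add: mult_a_minus)
  then have "u \<otimes> ((y \<ominus> k) \<otimes> z) = \<one>"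
    using z(2) carr k(2) \<open>z \<in> A\<close> A_carrier by (simp add: m_assoc)
  then have "b = (y \<ominus> k) \<otimes> z"
    using inv_unique[OF b(3)] carr k(2) \<open>z \<in> A\<close> A_carrier by simp
  then have "b \<in> A" using y k(1) I_A \<open>z \<in> A\<close> by simp
  then show "\<exists>y\<in>A. (\<one> \<oplus> a) \<otimes> y = \<one> \<and> y \<otimes> (\<one> \<oplus> a) = \<one>"
    using b(2,3) unfolding u_def by blast
qed simp

text \<open>A small representative \<open>j \<oplus> x\<close> need not lie in \<open>A\<close>.
  Replacing \<open>j\<close> by a nearby \<open>i\<close> in \<open>I\<close> gives a small element
  of \<open>A\<close>; the inverse that (P_A) then provides inverts \<open>\<one> \<oplus> x\<close>
  modulo \<open>I\<close>, hence modulo \<open>J\<close>.\<close>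

lemma P_A_imp_P_AI:
  assumes dense: "dense_in B I J" and P_A: "locally_spectral_invariant A B (\<lambda>a. a)"
  shows "locally_spectral_invariant (carrier (restrict_alg B A Quot I)) (quotient_algebra B J)
    (induced_map B J)"
proof -
  from P_A obtain \<epsilon> where "\<epsilon> > 0" and \<epsilon>: "\<And>x. x \<in> A \<Longrightarrow> nrm B x < \<epsilon> \<Longrightarrow>
      \<exists>y\<in>A. (\<one> \<oplus> x) \<otimes> y = \<one> \<and> y \<otimes> (\<one> \<oplus> x) = \<one>"
    unfolding P_A_iff by blast
  have "\<exists>y\<in>A. (\<one> \<oplus> x) \<otimes> y \<in> J +> \<one> \<and> y \<otimes> (\<one> \<oplus> x) \<in> J +> \<one>"
    if x: "x \<in> A" and j: "j \<in> J" "nrm B (j \<oplus> x) < \<epsilon>" for x j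
  proof -
    \<comment> \<open>The tolerance is the slack in the strict inequality, so
      \<open>i \<oplus> x\<close> stays in the \<epsilon>-ball.\<close>
    obtain i where i: "i \<in> I" "i \<in> carrier B" "nrm B (j \<ominus> i) < \<epsilon> - nrm B (j \<oplus> x)"
      using dense_in_approx[OF Metric_space_ndist dense j(1), of "\<epsilon> - nrm B (j \<oplus> x)"] j(2) by auto
    note carr = A_carrier[OF x] J.a_Hcarr[OF j(1)] i(2)
    have "(j \<oplus> x) \<ominus> (j \<ominus> i) = i \<oplus> x"
      using carr by algebra
    then have "nrm B (i \<oplus> x) < \<epsilon>"
      using nrm_diff[of "j \<oplus> x" "j \<ominus> i"] i(3) carr by simp
    then obtain y where y: "y \<in> A" "(\<one> \<oplus> (i \<oplus> x)) \<otimes> y = \<one>" "y \<otimes> (\<one> \<oplus> (i \<oplus> x)) = \<one>"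
      using \<epsilon> x I_A[OF i(1)] by (meson A_add)
    have "(\<one> \<oplus> x) \<otimes> y = \<ominus> (i \<otimes> y) \<oplus> (\<one> \<oplus> (i \<oplus> x)) \<otimes> y"
      and "y \<otimes> (\<one> \<oplus> x) = \<ominus> (y \<otimes> i) \<oplus> y \<otimes> (\<one> \<oplus> (i \<oplus> x))"
      using carr A_carrier[OF y(1)] by algebra+
    moreover have "\<ominus> (i \<otimes> y) \<in> J" "\<ominus> (y \<otimes> i) \<in> J"
      using I_mult[OF i(1) y(1)] I_subset_J by auto
    ultimately show ?thesis
      using y unfolding mem_coset by metis
  qed
  then show ?thesis
    unfolding P_AI_iff using \<open>\<epsilon> > 0\<close> by blast
qed

text \<open>Starting from \<open>a \<otimes> b = k \<oplus> \<one>\<close>, approximate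
  \<open>b\<close> by \<open>c\<close> in \<open>A\<close> and \<open>k\<close> by \<open>i\<close>
  in \<open>I\<close>. Then \<open>a \<otimes> c \<ominus> i\<close> is close to
  \<open>\<one>\<close> and has an inverse \<open>y\<close> in \<open>A\<close>, which makes
  \<open>c \<otimes> y\<close> a right inverse of \<open>a\<close> modulo \<open>I\<close>. The left
  side is treated symmetrically with its own data.\<close>

lemma P_A_imp_P_tilde:
  assumes dense_I: "dense_in B I J" and dense_A: "dense_in B A (carrier B)"
    and P_A: "locally_spectral_invariant A B (\<lambda>a. a)"
  shows "spectral_invariant (restrict_alg B A Quot I) (quotient_algebra B J) (induced_map B J)"
  unfolding P_tilde_iff
proof (intro ballI impI)
  from P_A obtain \<epsilon> where "\<epsilon> > 0" and \<epsilon>: "\<And>x. x \<in> A \<Longrightarrow> nrm B x < \<epsilon> \<Longrightarrow>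
      \<exists>y\<in>A. (\<one> \<oplus> x) \<otimes> y = \<one> \<and> y \<otimes> (\<one> \<oplus> x) = \<one>"
    unfolding P_A_iff by blast
  have close: "\<exists>c\<in>A. \<exists>i\<in>I. nrm B (k \<ominus> i) < \<epsilon> / 2 \<and> nrm B (a \<otimes> (b \<ominus> c)) < \<epsilon> / 2 \<and>
      nrm B ((b \<ominus> c) \<otimes> a) < \<epsilon> / 2"
    if "a \<in> A" "b \<in> carrier B" "k \<in> J" for a b k
  proof -
    have "\<epsilon> / 2 / (nrm B a + 1) > 0"
      using \<open>\<epsilon> > 0\<close> nrm_nonneg[OF A_carrier[OF \<open>a \<in> A\<close>]] by (simp add: add_nonneg_pos)
    then obtain c where c: "c \<in> A" "c \<in> carrier B" "nrm B (b \<ominus> c) < \<epsilon> / 2 / (nrm B a + 1)"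
      using dense_in_approx[OF Metric_space_ndist dense_A \<open>b \<in> carrier B\<close>] by metis
    moreover obtain i where "i \<in> I" "nrm B (k \<ominus> i) < \<epsilon> / 2"
      using dense_in_approx[OF Metric_space_ndist dense_I \<open>k \<in> J\<close>, of "\<epsilon> / 2"] \<open>\<epsilon> > 0\<close> by auto
    ultimately show ?thesis
      using nrm_mult_less[OF _ _ c(3)] that A_carrier by (meson minus_closed)
  qed
  \<comment> \<open>Here \<open>x\<close> stands for \<open>a \<otimes> c\<close> or
    \<open>c' \<otimes> a\<close>, and \<open>z\<close> for the error from approximating the
    inverse. The distance from \<open>x \<ominus> i\<close> to \<open>\<one>\<close> splits into
    \<open>k \<ominus> i\<close> and \<open>z\<close>, each allotted half of \<epsilon>.\<close>
  have inverse: "\<exists>y\<in>A. (x \<ominus> i) \<otimes> y = \<one> \<and> y \<otimes> (x \<ominus> i) = \<one>"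
    if "x \<in> A" "i \<in> I" "k \<in> J" "z \<in> carrier B" "nrm B (k \<ominus> i) < \<epsilon> / 2" "nrm B z < \<epsilon> / 2"
      "k \<oplus> \<one> \<ominus> x = z" for x i k z
  proof -
    note carr = A_carrier[OF that(1)] I_carrier[OF that(2)] J.a_Hcarr[OF that(3)] that(4)
    have "x \<ominus> i \<ominus> \<one> = (k \<ominus> i) \<ominus> z"
      using carr unfolding that(7)[symmetric] by algebra
    then have "nrm B (x \<ominus> i \<ominus> \<one>) < \<epsilon>"
      using nrm_diff[of "k \<ominus> i" z] that carr by simp
    moreover have "x \<ominus> i \<ominus> \<one> \<in> A" using that I_A by simp
    moreover have "\<one> \<oplus> (x \<ominus> i \<ominus> \<one>) = x \<ominus> i"
      using carr by algebra
    ultimately show ?thesis using \<epsilon> by metis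
  qed
  fix a assume a: "a \<in> A"
  assume "\<exists>c\<in>carrier B. \<exists>d\<in>carrier B. a \<otimes> c \<in> J +> \<one> \<and> d \<otimes> a \<in> J +> \<one>"
  then obtain b b' k k' where b: "b \<in> carrier B" "k \<in> J" "a \<otimes> b = k \<oplus> \<one>"
    and b': "b' \<in> carrier B" "k' \<in> J" "b' \<otimes> a = k' \<oplus> \<one>"
    unfolding mem_coset by metis
  obtain c i where c: "c \<in> A" "i \<in> I" "nrm B (k \<ominus> i) < \<epsilon> / 2" "nrm B (a \<otimes> (b \<ominus> c)) < \<epsilon> / 2"
    using close[OF a b(1,2)] by auto
  have "k \<oplus> \<one> \<ominus> a \<otimes> c = a \<otimes> (b \<ominus> c)"
    using a b c A_carrier by (simp add: mult_a_minus)
  then obtain y where y: "y \<in> A" "(a \<otimes> c \<ominus> i) \<otimes> y = \<one>"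
    using inverse[of "a \<otimes> c" i k "a \<otimes> (b \<ominus> c)"] a b c A_carrier by auto
  have "a \<otimes> (c \<otimes> y) = i \<otimes> y \<oplus> (a \<otimes> c \<ominus> i) \<otimes> y"
    using A_carrier[OF a] A_carrier[OF c(1)] A_carrier[OF y(1)] I_carrier[OF c(2)] by algebra
  then have right: "a \<otimes> (c \<otimes> y) \<in> I +> \<one>"
    using I_mult(2)[OF c(2) y(1)] y(2) by (auto simp: mem_coset)
  obtain c' i' where c': "c' \<in> A" "i' \<in> I" "nrm B (k' \<ominus> i') < \<epsilon> / 2"
      "nrm B ((b' \<ominus> c') \<otimes> a) < \<epsilon> / 2"
    using close[OF a b'(1,2)] by auto
  have "k' \<oplus> \<one> \<ominus> c' \<otimes> a = (b' \<ominus> c') \<otimes> a"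
    using a b' c' A_carrier by (simp add: mult_a_minus)
  then obtain y' where y': "y' \<in> A" "y' \<otimes> (c' \<otimes> a \<ominus> i') = \<one>"
    using inverse[of "c' \<otimes> a" i' k' "(b' \<ominus> c') \<otimes> a"] a b' c' A_carrier by auto
  have "(y' \<otimes> c') \<otimes> a = y' \<otimes> i' \<oplus> y' \<otimes> (c' \<otimes> a \<ominus> i')"
    using A_carrier[OF a] A_carrier[OF c'(1)] A_carrier[OF y'(1)] I_carrier[OF c'(2)] by algebra
  then have "(y' \<otimes> c') \<otimes> a \<in> I +> \<one>"
    using I_mult(1)[OF c'(2) y'(1)] y'(2) by (auto simp: mem_coset)
  then show "\<exists>c\<in>A. \<exists>d\<in>A. a \<otimes> c \<in> I +> \<one> \<and> d \<otimes> a \<in> I +> \<one>"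
    using right c(1) y(1) c'(1) y'(1) by (meson A_mult)
qed

text \<open>Solving \<open>(\<one> \<oplus> x) \<otimes> y = \<one>\<close> for \<open>y\<close>
  gives \<open>y = \<one> \<oplus> \<ominus> (x \<otimes> y)\<close>, and
  \<open>x \<otimes> y\<close> lies in \<open>I\<close> because \<open>y\<close> is in
  \<open>A\<close>.\<close>

lemma P_A_imp_P_I:
  assumes "locally_spectral_invariant A B (\<lambda>a. a)"
  shows "locally_spectral_invariant I (restrict_alg B (unitization B J)) (\<lambda>i. i)"
proof -
  from assms obtain \<epsilon> where "\<epsilon> > 0" and \<epsilon>: "\<And>x. x \<in> A \<Longrightarrow> nrm B x < \<epsilon> \<Longrightarrow>
      \<exists>y\<in>A. (\<one> \<oplus> x) \<otimes> y = \<one> \<and> y \<otimes> (\<one> \<oplus> x) = \<one>"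
    unfolding P_A_iff by blast
  have "\<exists>y\<in>unitization B I. (\<one> \<oplus> x) \<otimes> y = \<one> \<and> y \<otimes> (\<one> \<oplus> x) = \<one>"
    if x: "x \<in> I" "nrm B x < \<epsilon>" for x
  proof -
    obtain y where y: "y \<in> A" "(\<one> \<oplus> x) \<otimes> y = \<one>" "y \<otimes> (\<one> \<oplus> x) = \<one>"
      using \<epsilon> x I_A by blast
    have "y = (\<one> \<oplus> x) \<otimes> y \<oplus> \<ominus> (x \<otimes> y)"
      using A_carrier[OF y(1)] I_carrier[OF x(1)] by algebra
    then have "y = \<one> \<oplus> \<ominus> (x \<otimes> y)" using y(2) by simp
    moreover have "\<ominus> (x \<otimes> y) \<in> I" using x(1) y(1) by (simp add: I_uminus I_mult)
    ultimately have "y \<in> unitization B I" using one_plus_mem_unitization by metis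
    then show ?thesis using y by blast
  qed
  then show ?thesis unfolding P_I_iff using \<open>\<epsilon> > 0\<close> by blast
qed

text \<open>A representative \<open>j \<oplus> x\<close> of norm below 1 makes
  \<open>\<one> \<oplus> (j \<oplus> x)\<close> a unit of \<open>B\<close>, so
  \<open>\<one> \<oplus> x\<close> is invertible modulo \<open>J\<close>. The hypothesis moves the
  inverses into \<open>A\<close>, one for each side.\<close>

lemma P_tilde_imp_P_AI:
  assumes P_tilde: "spectral_invariant (restrict_alg B A Quot I) (quotient_algebra B J)
      (induced_map B J)"
  shows "locally_spectral_invariant (carrier (restrict_alg B A Quot I)) (quotient_algebra B J)
    (induced_map B J)"
  unfolding P_AI_iff
proof (intro exI[of _ 1] conjI ballI impI)
  fix x assume x: "x \<in> A" and "\<exists>j\<in>J. nrm B (j \<oplus> x) < 1"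
  then obtain j where j: "j \<in> J" "nrm B (j \<oplus> x) < 1" by auto
  note carr = A_carrier[OF x] J.a_Hcarr[OF j(1)]
  have "\<one> \<oplus> (j \<oplus> x) \<in> Units B" using one_plus_Units j(2) carr by simp
  moreover have "\<ominus> j \<oplus> (\<one> \<oplus> (j \<oplus> x)) = \<one> \<oplus> x" using carr by algebra
  ultimately obtain v where v: "v \<in> carrier B" "(\<one> \<oplus> x) \<otimes> v \<in> J +> \<one>" "v \<otimes> (\<one> \<oplus> x) \<in> J +> \<one>"
    using Units_imp_coset_inverses[of "\<one> \<oplus> (j \<oplus> x)" "\<ominus> j"] j(1) by auto
  then have "\<exists>c\<in>A. \<exists>d\<in>A. (\<one> \<oplus> x) \<otimes> c \<in> I +> \<one> \<and> d \<otimes> (\<one> \<oplus> x) \<in> I +> \<one>"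
    using P_tilde[unfolded P_tilde_iff, rule_format, of "\<one> \<oplus> x"] x by auto
  then obtain c d where c: "c \<in> A" "(\<one> \<oplus> x) \<otimes> c \<in> I +> \<one>"
    and d: "d \<in> A" "d \<otimes> (\<one> \<oplus> x) \<in> I +> \<one>"
    by blast
  have "I +> \<one> \<subseteq> J +> \<one>"
    using I_subset_J unfolding mem_coset subset_iff by blast
  then have J: "(\<one> \<oplus> x) \<otimes> c \<in> J +> \<one>" "d \<otimes> (\<one> \<oplus> x) \<in> J +> \<one>" using c(2) d(2) by auto
  \<comment> \<open>The right inverse \<open>c\<close> and the left inverse \<open>d\<close> were
    obtained separately; modulo \<open>J\<close>, \<open>c\<close> serves on both sides.\<close>
  then have "c \<otimes> (\<one> \<oplus> x) \<in> J +> \<one>"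
    using J.right_inverse_mod_imp_left[of "\<one> \<oplus> x" c d] carr(1) c(1) d(1) A_carrier by simp
  then show "\<exists>y\<in>A. (\<one> \<oplus> x) \<otimes> y \<in> J +> \<one> \<and> y \<otimes> (\<one> \<oplus> x) \<in> J +> \<one>"
    using J(1) c(1) by blast
qed simp

text \<open>An inverse \<open>b\<close> modulo \<open>J\<close> is approximated in the quotient norm
  by \<open>c\<close> in \<open>A\<close>, so the class of \<open>a \<otimes> c\<close> is close to
  the unit. (P_{A/I}) inverts it modulo \<open>J\<close> by some \<open>y\<close> in
  \<open>A\<close>, and \<open>inj_coset\<close> turns the resulting congruence into one modulo
  \<open>I\<close>.\<close>

lemma P_AI_imp_P_tilde:
  assumes inj: "inj_on (induced_map B J) (carrier (restrict_alg B A Quot I))"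
    and dense: "dense_in (quotient_algebra B J)
      (induced_map B J ` carrier (restrict_alg B A Quot I)) (carrier (quotient_algebra B J))"
    and P_AI: "locally_spectral_invariant (carrier (restrict_alg B A Quot I))
      (quotient_algebra B J) (induced_map B J)"
  shows "spectral_invariant (restrict_alg B A Quot I) (quotient_algebra B J) (induced_map B J)"
  unfolding P_tilde_iff
proof (intro ballI impI)
  from P_AI obtain \<epsilon> where "\<epsilon> > 0" and \<epsilon>: "\<And>x j. x \<in> A \<Longrightarrow> j \<in> J \<Longrightarrow> nrm B (j \<oplus> x) < \<epsilon> \<Longrightarrow>
      \<exists>y\<in>A. (\<one> \<oplus> x) \<otimes> y \<in> J +> \<one> \<and> y \<otimes> (\<one> \<oplus> x) \<in> J +> \<one>"
    unfolding P_AI_iff by blast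
  have close: "\<exists>c\<in>A. \<exists>j\<in>J. nrm B (a \<otimes> (j \<oplus> (b \<ominus> c))) < \<epsilon> \<and> nrm B ((j \<oplus> (b \<ominus> c)) \<otimes> a) < \<epsilon>"
    if "a \<in> A" "b \<in> carrier B" for a b
  proof -
    have "\<epsilon> / (nrm B a + 1) > 0"
      using \<open>\<epsilon> > 0\<close> nrm_nonneg[OF A_carrier[OF \<open>a \<in> A\<close>]] by (simp add: add_nonneg_pos)
    then obtain c j where c: "c \<in> A" "j \<in> J" "nrm B (j \<oplus> (b \<ominus> c)) < \<epsilon> / (nrm B a + 1)"
      using quotient_dense_approx[OF dense \<open>b \<in> carrier B\<close>] by metis
    then show ?thesis
      using nrm_mult_less[OF _ _ c(3)] that A_carrier J.a_Hcarr by (meson minus_closed a_closed)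
  qed
  have inverse: "\<exists>y\<in>A. x \<otimes> y \<in> J +> \<one> \<and> y \<otimes> x \<in> J +> \<one>"
    if "x \<in> A" "k \<in> J" "z \<in> carrier B" "nrm B z < \<epsilon>" "k \<oplus> \<one> \<ominus> x = z" for x k z
  proof -
    note carr = A_carrier[OF that(1)] J.a_Hcarr[OF that(2)] that(3)
    \<comment> \<open>This exhibits a small representative of the class of
      \<open>x \<ominus> \<one>\<close>, with \<open>\<ominus> k\<close> as the element of
      \<open>J\<close>.\<close>
    have "\<ominus> k \<oplus> (x \<ominus> \<one>) = \<ominus> z"
      using carr unfolding that(5)[symmetric] by algebra
    then have "nrm B (\<ominus> k \<oplus> (x \<ominus> \<one>)) < \<epsilon>"
      using nrm_minus that carr by simp
    moreover have "\<one> \<oplus> (x \<ominus> \<one>) = x"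
      using carr by algebra
    ultimately show ?thesis using \<epsilon>[of "x \<ominus> \<one>" "\<ominus> k"] that(1,2) by simp
  qed
  fix a assume a: "a \<in> A"
  assume "\<exists>c\<in>carrier B. \<exists>d\<in>carrier B. a \<otimes> c \<in> J +> \<one> \<and> d \<otimes> a \<in> J +> \<one>"
  then obtain b b' k k' where b: "b \<in> carrier B" "k \<in> J" "a \<otimes> b = k \<oplus> \<one>"
    and b': "b' \<in> carrier B" "k' \<in> J" "b' \<otimes> a = k' \<oplus> \<one>"
    unfolding mem_coset by metis
  obtain c j where c: "c \<in> A" "j \<in> J" "nrm B (a \<otimes> (j \<oplus> (b \<ominus> c))) < \<epsilon>"
    using close[OF a b(1)] by auto
  note carr = A_carrier[OF a] A_carrier[OF c(1)] J.a_Hcarr[OF c(2)] b(1) J.a_Hcarr[OF b(2)]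
  \<comment> \<open>The \<open>j\<close> that comes with approximation in the quotient norm is
    absorbed into the ideal part, so \<open>a \<otimes> j \<oplus> k\<close> takes over the role of
    \<open>k\<close>.\<close>
  have "(a \<otimes> j \<oplus> k) \<oplus> \<one> \<ominus> a \<otimes> c = a \<otimes> j \<oplus> (a \<otimes> b \<ominus> a \<otimes> c)"
    unfolding b(3) using carr by algebra
  also have "\<dots> = a \<otimes> (j \<oplus> (b \<ominus> c))"
    using carr by algebra
  finally have eq: "(a \<otimes> j \<oplus> k) \<oplus> \<one> \<ominus> a \<otimes> c = a \<otimes> (j \<oplus> (b \<ominus> c))" .
  have "a \<otimes> j \<oplus> k \<in> J"
    using b(2) c(2) carr(1) by (simp add: J.I_l_closed)
  then obtain y where y: "y \<in> A" "(a \<otimes> c) \<otimes> y \<in> J +> \<one>"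
    using inverse[OF A_mult[OF a c(1)] _ _ c(3) eq] carr by auto
  then have right: "a \<otimes> (c \<otimes> y) \<in> I +> \<one>"
    using inj_coset[OF inj] a c(1) A_carrier by (simp add: m_assoc)
  obtain c' j' where c': "c' \<in> A" "j' \<in> J" "nrm B ((j' \<oplus> (b' \<ominus> c')) \<otimes> a) < \<epsilon>"
    using close[OF a b'(1)] by auto
  note carr' = A_carrier[OF a] A_carrier[OF c'(1)] J.a_Hcarr[OF c'(2)] b'(1) J.a_Hcarr[OF b'(2)]
  have "(j' \<otimes> a \<oplus> k') \<oplus> \<one> \<ominus> c' \<otimes> a = j' \<otimes> a \<oplus> (b' \<otimes> a \<ominus> c' \<otimes> a)"
    unfolding b'(3) using carr' by algebra
  also have "\<dots> = (j' \<oplus> (b' \<ominus> c')) \<otimes> a"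
    using carr' by algebra
  finally have eq': "(j' \<otimes> a \<oplus> k') \<oplus> \<one> \<ominus> c' \<otimes> a = (j' \<oplus> (b' \<ominus> c')) \<otimes> a" .
  have "j' \<otimes> a \<oplus> k' \<in> J"
    using b'(2) c'(2) carr'(1) by (simp add: J.I_r_closed)
  then obtain y' where y': "y' \<in> A" "y' \<otimes> (c' \<otimes> a) \<in> J +> \<one>"
    using inverse[OF A_mult[OF c'(1) a] _ _ c'(3) eq'] carr' by auto
  then have "(y' \<otimes> c') \<otimes> a \<in> I +> \<one>"
    using inj_coset[OF inj] a c'(1) A_carrier by (simp add: m_assoc)
  then show "\<exists>c\<in>A. \<exists>d\<in>A. a \<otimes> c \<in> I +> \<one> \<and> d \<otimes> a \<in> I +> \<one>"
    using right c(1) y(1) c'(1) y'(1) by (meson A_mult)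
qed

end

theorem theorem1:
  fixes B :: "'a normed_algebra" and A J I :: "'a set"
  assumes "unital_banach_algebra B"
    and "unital_subalgebra A B"
    and "ideal J B" and "J \<noteq> carrier B" and "closedin (ntopology B) J"
    and "ideal I (restrict_alg B A)" and "I \<subseteq> J"
  shows "let A_I = restrict_alg B A Quot I;
             B_J = quotient_algebra B J;
             \<phi> = induced_map B J;
             P_A = locally_spectral_invariant A B (\<lambda>a. a);
             P_I = locally_spectral_invariant I (restrict_alg B (unitization B J)) (\<lambda>i. i);
             P_AI = locally_spectral_invariant (carrier A_I) B_J \<phi>;
             P_tilde = spectral_invariant A_I B_J \<phi>
         in (dense_in B I J \<longrightarrow> P_I \<and> P_tilde \<longrightarrow> P_A) \<and>
            (dense_in B I J \<longrightarrow> P_A \<longrightarrow> P_AI) \<and>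
            (dense_in B I J \<and> dense_in B A (carrier B) \<longrightarrow> P_A \<longrightarrow> P_tilde) \<and>
            (P_A \<longrightarrow> P_I) \<and>
            (P_tilde \<longrightarrow> P_AI) \<and>
            (inj_on \<phi> (carrier A_I) \<and> dense_in B_J (\<phi> ` carrier A_I) (carrier B_J)
              \<longrightarrow> (P_AI \<longleftrightarrow> P_tilde))"
proof -
  interpret banach_ideal_pair B A J I
    using assms by (simp add: banach_ideal_pair_def banach_ideal_pair_axioms_def)
  show ?thesis
    unfolding Let_def
    using P_I_and_P_tilde_imp_P_A P_A_imp_P_AI P_A_imp_P_tilde P_A_imp_P_I P_tilde_imp_P_AI
      P_AI_imp_P_tilde
    by blast
qed

end
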